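(* Let $\alpha_+,\alpha_-$ be real numbers with $0\le\alpha_+\le\alpha_-$ and $\alpha_++\alpha_-\le1$, and let $\mathfrak{n}_{(\alpha_+,\alpha_-)}\in\mathcal{D}_{6,2}$ be the corresponding metric $2$-step nilpotent Lie algebra. Then $\mathfrak{n}_{(\alpha_+,\alpha_-)}$ has infinitesimal rank one, with the exception of $\mathfrak{n}_{(0,0)}\cong\mathfrak{h}_3\oplus\mathfrak{h}_3$ and $\mathfrak{n}_{(1/2,1/2)}\cong\mathfrak{n}_5\oplus\mathbb{R}$, both endowed with the product metric, whose infinitesimal rank is two.
   Context: $\mathfrak{n}_{(\alpha_+,\alpha_-)}$ is the $6$-dimensional metric Lie algebra with orthonormal basis $(e_1,\dots,e_6)$ whose dual basis $(e^i)$ satisfies $$de^i=0\ (i=1,\dots,4),\quad de^5=(a_-+p)\,e^1\wedge e^2+(a_--p)\,e^3\wedge e^4,\quad de^6=(b_-+q)\,e^1\wedge e^3-(b_--q)\,e^2\wedge e^4,$$ where $a_-=\sqrt{\alpha_-}$, $b_-=\sqrt{\beta_-}$, $p=\sqrt{\beta_+}$, $q=\sqrt{\alpha_+}$ and $\beta_+=1-\alpha_-$, $\beta_-=1-\alpha_+$. These represent all classes in $\mathcal{D}_{6,2}$, the set of isometric isomorphism classes of $6$-dimensional metric $2$-step nilpotent Lie algebras with $2$-dimensional commutator ideal $\mathbb{R}^2$ for which the adjoint $j\colon\mathbb{R}^2\to\mathfrak{so}(4)$ of the Lie bracket is isometric (with $\mathfrak{so}(4)\cong\Lambda^2\mathbb{R}^4$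 given the scalar product for which $e^1\wedge e^2\pm e^3\wedge e^4$, $e^1\wedge e^3\mp e^2\wedge e^4$, $e^1\wedge e^4\pm e^2\wedge e^3$ are orthonormal). $\mathfrak{h}_3$ is the real $3$-dimensional Heisenberg algebra and $\mathfrak{n}_5$ is the $5$-dimensional Lie algebra with $de^1=de^2=de^3=0$, $de^4=e^1\wedge e^2$, $de^5=e^1\wedge e^3$. For a Riemannian manifold $M$ with curvature tensor $R$ and $v\in T_pM$, the Jacobi operator is the endomorphism $R_v\colon w\mapsto R_{v,w}v$ of $T_pM$. The infinitesimal rank of $M$ is the minimal dimension of the kernels of the Jacobi operators $R_v$ (over all nonzero tangent vectors $v$). The infinitesimal rank of a metric Lie algebra is that of the corresponding simply connected Lie group with its left-invariant metric. *)

theory Defs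
  imports "HOL-Analysis.Analysis"
begin

section \<open>Riemannian metrics on a vector space, in the global chart\<close>

text \<open>
  A Riemannian metric on the manifold \<open>'a\<close> is a function \<open>g\<close> such that \<open>g x\<close> is a scalar product on
  the tangent space \<open>'a\<close> at \<open>x\<close>; vector fields are functions \<open>'a \<Rightarrow> 'a\<close>. For a differentiable
  non-degenerate \<open>g\<close>, the description in \<open>christoffel\<close> determines a unique vector.
\<close>

definition christoffel ::
    "('a::euclidean_space \<Rightarrow> 'a \<Rightarrow> 'a \<Rightarrow> real) \<Rightarrow> 'a \<Rightarrow> 'a \<Rightarrow> 'a \<Rightarrow> 'a" where
  "christoffel g x u v = (THE z. \<forall>w. 2 * g x z w =
      frechet_derivative (\<lambda>y. g y v w) (at x) u
    + frechet_derivative (\<lambda>y. g y u w) (at x) v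
    - frechet_derivative (\<lambda>y. g y u v) (at x) w)"

definition levi_civita ::
    "('a::euclidean_space \<Rightarrow> 'a \<Rightarrow> 'a \<Rightarrow> real) \<Rightarrow> ('a \<Rightarrow> 'a) \<Rightarrow> ('a \<Rightarrow> 'a) \<Rightarrow> 'a \<Rightarrow> 'a" where
  "levi_civita g X Y x = frechet_derivative Y (at x) (X x) + christoffel g x (X x) (Y x)"

definition vf_bracket :: "('a::euclidean_space \<Rightarrow> 'a) \<Rightarrow> ('a \<Rightarrow> 'a) \<Rightarrow> 'a \<Rightarrow> 'a" where
  "vf_bracket X Y x = frechet_derivative Y (at x) (X x) - frechet_derivative X (at x) (Y x)"

definition curvature_field ::
    "('a::euclidean_space \<Rightarrow> 'a \<Rightarrow> 'a \<Rightarrow> real) \<Rightarrow> ('a \<Rightarrow> 'a) \<Rightarrow> ('a \<Rightarrow> 'a) \<Rightarrow> ('a \<Rightarrow> 'a) \<Rightarrow> 'a \<Rightarrow> 'a" where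
  "curvature_field g X Y Z x =
      levi_civita g X (levi_civita g Y Z) x
    - levi_civita g Y (levi_civita g X Z) x
    - levi_civita g (vf_bracket X Y) Z x"

text \<open>By tensoriality, tangent vectors may be extended to constant vector fields.\<close>

definition curvature ::
    "('a::euclidean_space \<Rightarrow> 'a \<Rightarrow> 'a \<Rightarrow> real) \<Rightarrow> 'a \<Rightarrow> 'a \<Rightarrow> 'a \<Rightarrow> 'a \<Rightarrow> 'a" where
  "curvature g x u v w = curvature_field g (\<lambda>_. u) (\<lambda>_. v) (\<lambda>_. w) x"

definition jacobi_operator ::
    "('a::euclidean_space \<Rightarrow> 'a \<Rightarrow> 'a \<Rightarrow> real) \<Rightarrow> 'a \<Rightarrow> 'a \<Rightarrow> 'a \<Rightarrow> 'a" where
  "jacobi_operator g x v w = curvature g x v w v"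

definition riemannian_infinitesimal_rank ::
    "('a::euclidean_space \<Rightarrow> 'a \<Rightarrow> 'a \<Rightarrow> real) \<Rightarrow> nat" where
  "riemannian_infinitesimal_rank g =
     Inf {dim {w. jacobi_operator g x v w = 0} | x v. v \<noteq> 0}"


section \<open>2-step nilpotent metric Lie algebras\<close>

text \<open>
  The scalar product is the given one of the Euclidean space. The Jacobi identity follows from the
  third condition.
\<close>

definition two_step_nilpotent :: "('a::euclidean_space \<Rightarrow> 'a \<Rightarrow> 'a) \<Rightarrow> bool" where
  "two_step_nilpotent br \<longleftrightarrow>
     bilinear br \<and> (\<forall>x. br x x = 0) \<and> (\<forall>x y z. br (br x y) z = 0)"

text \<open>
  For a 2-step nilpotent Lie algebra, the Baker-Campbell-Hausdorff series stops after the first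
  bracket, and the simply connected Lie group is the vector space itself with the following product
  (neutral element \<open>0\<close>, inverse \<open>- x\<close>; the exponential map is the identity).
\<close>

definition group_mult :: "('a::euclidean_space \<Rightarrow> 'a \<Rightarrow> 'a) \<Rightarrow> 'a \<Rightarrow> 'a \<Rightarrow> 'a" where
  "group_mult br x y = x + y + (1/2) *\<^sub>R br x y"

definition left_invariant_metric ::
    "('a::euclidean_space \<Rightarrow> 'a \<Rightarrow> 'a) \<Rightarrow> 'a \<Rightarrow> 'a \<Rightarrow> 'a \<Rightarrow> real" where
  "left_invariant_metric br x u v =
     frechet_derivative (group_mult br (- x)) (at x) u \<bullet>
     frechet_derivative (group_mult br (- x)) (at x) v"

definition infinitesimal_rank :: "('a::euclidean_space \<Rightarrow> 'a \<Rightarrow> 'a) \<Rightarrow> nat" where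
  "infinitesimal_rank br = riemannian_infinitesimal_rank (left_invariant_metric br)"

lemma group_mult_laws:
  assumes "two_step_nilpotent br"
  shows "group_mult br 0 x = x" "group_mult br x 0 = x"
    and "group_mult br (- x) x = 0" "group_mult br x (- x) = 0"
    and "group_mult br (group_mult br x y) z = group_mult br x (group_mult br y z)"
proof -
  have bil: "bilinear br" and alt: "\<And>x. br x x = 0" and nil: "\<And>x y z. br (br x y) z = 0"
    using assms by (auto simp: two_step_nilpotent_def)
  have "br (x + y) (x + y) = br x x + br x y + (br y x + br y y)" for x y
    by (simp add: bilinear_ladd[OF bil] bilinear_radd[OF bil])
  then have "br x y + br y x = 0" for x y
    using alt[of "x + y"] by (simp add: alt)
  then have anti: "br x y = - br y x" for x y
    by (simp add: eq_neg_iff_add_eq_0)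
  have nil': "br x (br y z) = 0" for x y z
    using anti[of x "br y z"] nil by simp
  note bils = bilinear_ladd[OF bil] bilinear_radd[OF bil] bilinear_lmul[OF bil] bilinear_rmul[OF bil]
    bilinear_lneg[OF bil] bilinear_rneg[OF bil] bilinear_lzero[OF bil] bilinear_rzero[OF bil]
  show "group_mult br 0 x = x" "group_mult br x 0 = x"
    "group_mult br (- x) x = 0" "group_mult br x (- x) = 0"
    by (simp_all add: group_mult_def bils alt)
  show "group_mult br (group_mult br x y) z = group_mult br x (group_mult br y z)"
    by (simp add: group_mult_def bils nil nil' scaleR_add_right)
qed

lemma frechet_derivative_group_mult:
  assumes "bilinear br"
  shows "frechet_derivative (group_mult br a) (at x) = (\<lambda>u. u + (1/2) *\<^sub>R br a u)"
proof -
  have "bounded_linear (br a)"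
    using assms by (simp add: bilinear_def linear_conv_bounded_linear)
  then have "(group_mult br a has_derivative (\<lambda>u. u + (1/2) *\<^sub>R br a u)) (at x)"
    unfolding group_mult_def
    by (auto intro!: derivative_eq_intros bounded_linear.has_derivative[of "br a"])
  then show ?thesis
    by (rule frechet_derivative_at[symmetric])
qed

lemma left_invariant_metric_invariant:
  assumes "two_step_nilpotent br"
  shows "left_invariant_metric br (group_mult br a x)
           (frechet_derivative (group_mult br a) (at x) u)
           (frechet_derivative (group_mult br a) (at x) v) = left_invariant_metric br x u v"
    and "left_invariant_metric br 0 u v = u \<bullet> v"
proof -
  have bil: "bilinear br" and alt: "\<And>x. br x x = 0" and nil: "\<And>x y z. br (br x y) z = 0"
    using assms by (auto simp: two_step_nilpotent_def)
  have "br (x + y) (x + y) = br x x + br x y + (br y x + br y y)" for x y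
    by (simp add: bilinear_ladd[OF bil] bilinear_radd[OF bil])
  then have "br x y + br y x = 0" for x y
    using alt[of "x + y"] by (simp add: alt)
  then have anti: "br x y = - br y x" for x y
    by (simp add: eq_neg_iff_add_eq_0)
  have nil': "br x (br y z) = 0" for x y z
    using anti[of x "br y z"] nil by simp
  note bils = bilinear_ladd[OF bil] bilinear_radd[OF bil] bilinear_lmul[OF bil] bilinear_rmul[OF bil]
    bilinear_lneg[OF bil] bilinear_rneg[OF bil] bilinear_lzero[OF bil] bilinear_rzero[OF bil]
    bilinear_lsub[OF bil]
  show "left_invariant_metric br (group_mult br a x)
           (frechet_derivative (group_mult br a) (at x) u)
           (frechet_derivative (group_mult br a) (at x) v) = left_invariant_metric br x u v"
    by (simp add: left_invariant_metric_def frechet_derivative_group_mult[OF bil]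
        group_mult_def bils nil nil' algebra_simps)
  show "left_invariant_metric br 0 u v = u \<bullet> v"
    by (simp add: left_invariant_metric_def frechet_derivative_group_mult[OF bil] bils)
qed


section \<open>Lie algebras given by structure equations\<close>

definition wedge :: "'n \<Rightarrow> 'n \<Rightarrow> real^'n \<Rightarrow> real^'n \<Rightarrow> real" where
  "wedge i j x y = x $ i * y $ j - x $ j * y $ i"

text \<open>The bracket with given \<open>de\<^sup>i\<close>, in the convention \<open>d\<omega>(x,y) = - \<omega>([x,y])\<close>.\<close>

definition structure_bracket ::
    "('n::finite \<Rightarrow> real^'n \<Rightarrow> real^'n \<Rightarrow> real) \<Rightarrow> real^'n \<Rightarrow> real^'n \<Rightarrow> real^'n" where
  "structure_bracket de x y = (\<chi> i. - de i x y)"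

text \<open>In the numeral type \<open>6\<close> the index \<open>6\<close> is just another name for \<open>0\<close> (similarly for \<open>3\<close> and \<open>5\<close>).\<close>

definition n_bracket :: "real \<Rightarrow> real \<Rightarrow> real^6 \<Rightarrow> real^6 \<Rightarrow> real^6" where
  "n_bracket \<alpha>p \<alpha>m =
    (let \<beta>p = 1 - \<alpha>m; \<beta>m = 1 - \<alpha>p;
         a = sqrt \<alpha>m; b = sqrt \<beta>m; p = sqrt \<beta>p; q = sqrt \<alpha>p
     in structure_bracket (\<lambda>i x y.
          if i = 5 then (a + p) * wedge 1 2 x y + (a - p) * wedge 3 4 x y
          else if i = 6 then (b + q) * wedge 1 3 x y - (b - q) * wedge 2 4 x y
          else 0))"

definition h3_bracket :: "real^3 \<Rightarrow> real^3 \<Rightarrow> real^3" where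
  "h3_bracket = structure_bracket (\<lambda>i x y. if i = 3 then wedge 1 2 x y else 0)"

definition n5_bracket :: "real^5 \<Rightarrow> real^5 \<Rightarrow> real^5" where
  "n5_bracket = structure_bracket (\<lambda>i x y.
     if i = 4 then wedge 1 2 x y else if i = 5 then wedge 1 3 x y else 0)"

definition abelian_bracket :: "'a::euclidean_space \<Rightarrow> 'a \<Rightarrow> 'a" where
  "abelian_bracket x y = 0"

definition direct_sum_bracket ::
    "('a \<Rightarrow> 'a \<Rightarrow> 'a) \<Rightarrow> ('b \<Rightarrow> 'b \<Rightarrow> 'b) \<Rightarrow> 'a \<times> 'b \<Rightarrow> 'a \<times> 'b \<Rightarrow> 'a \<times> 'b" where
  "direct_sum_bracket br1 br2 x y = (br1 (fst x) (fst y), br2 (snd x) (snd y))"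

definition scalar_product :: "('a::real_vector \<Rightarrow> 'a \<Rightarrow> real) \<Rightarrow> bool" where
  "scalar_product s \<longleftrightarrow> bilinear s \<and> (\<forall>x y. s x y = s y x) \<and> (\<forall>x. x \<noteq> 0 \<longrightarrow> s x x > 0)"

text \<open>
  The metric Lie algebra with bracket \<open>br\<close> and the standard scalar product is isometrically
  isomorphic to the direct sum of \<open>br1\<close> and \<open>br2\<close>, with the product of some scalar products
  on the two summands.
\<close>

definition isometric_to_product ::
    "('a::euclidean_space \<Rightarrow> 'a \<Rightarrow> 'a) \<Rightarrow>
     ('b::euclidean_space \<Rightarrow> 'b \<Rightarrow> 'b) \<Rightarrow> ('c::euclidean_space \<Rightarrow> 'c \<Rightarrow> 'c) \<Rightarrow> bool" where
  "isometric_to_product br br1 br2 \<longleftrightarrow>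
     (\<exists>(\<phi> :: 'b \<times> 'c \<Rightarrow> 'a) s1 s2.
        scalar_product s1 \<and> scalar_product s2 \<and> linear \<phi> \<and> bij \<phi> \<and>
        (\<forall>x y. \<phi> (direct_sum_bracket br1 br2 x y) = br (\<phi> x) (\<phi> y)) \<and>
        (\<forall>x y. \<phi> x \<bullet> \<phi> y = s1 (fst x) (fst y) + s2 (snd x) (snd y)))"

lemma two_step_nilpotent_n_bracket: "two_step_nilpotent (n_bracket \<alpha>p \<alpha>m)"
proof -
  have "bilinear (n_bracket \<alpha>p \<alpha>m)"
    unfolding bilinear_def n_bracket_def Let_def structure_bracket_def wedge_def
    by (auto intro!: linearI simp: vec_eq_iff algebra_simps)
  moreover have "n_bracket \<alpha>p \<alpha>m x x = 0" for x
    by (simp add: n_bracket_def Let_def structure_bracket_def wedge_def vec_eq_iff)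
  moreover have "n_bracket \<alpha>p \<alpha>m (n_bracket \<alpha>p \<alpha>m x y) z = 0" for x y z
    by (simp add: n_bracket_def Let_def structure_bracket_def wedge_def vec_eq_iff)
  ultimately show ?thesis
    by (simp add: two_step_nilpotent_def)
qed

end

theory Submission
  imports Defs
begin

text \<open>
  Left translations identify every tangent space with the Lie algebra and turn the curvature tensor
  into the algebraic one computed from the Levi-Civita product
  \<open>\<nabla>\<^sub>a b = 1/2 ([a, b] - ad\<^sub>a\<^sup>* b - ad\<^sub>b\<^sup>* a)\<close>, so only Jacobi operators at the identity matter. A nonzero
  vector lies in the kernel of its own Jacobi operator, hence the rank is at least one. Away from
  the two exceptional points, the Jacobi operator of \<open>e\<^sub>2 + (b\<^sub>- - q) e\<^sub>5\<close> has a kernel of dimension one.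
  At the exceptional points, the product structure gives a second kernel vector for every \<open>v\<close>:
  for the first, the image of \<open>v\<close> under the isometry acting by \<open>1\<close> and \<open>- 1\<close> on the two factors (or a
  vector of the other factor); for the second, a vector of the flat factor \<open>e\<^sub>4\<close>.
\<close>

section \<open>Curvature of 2-step nilpotent metric Lie groups\<close>

definition lie_connection :: "('a::euclidean_space \<Rightarrow> 'a \<Rightarrow> 'a) \<Rightarrow> 'a \<Rightarrow> 'a \<Rightarrow> 'a" where
  "lie_connection br a b = (1/2) *\<^sub>R (br a b - adjoint (br a) b - adjoint (br b) a)"

definition lie_curvature :: "('a::euclidean_space \<Rightarrow> 'a \<Rightarrow> 'a) \<Rightarrow> 'a \<Rightarrow> 'a \<Rightarrow> 'a \<Rightarrow> 'a" where
  "lie_curvature br a b c =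
     lie_connection br a (lie_connection br b c) - lie_connection br b (lie_connection br a c)
     - lie_connection br (br a b) c"

definition lie_jacobi_kernel :: "('a::euclidean_space \<Rightarrow> 'a \<Rightarrow> 'a) \<Rightarrow> 'a \<Rightarrow> 'a set" where
  "lie_jacobi_kernel br v = {w. lie_curvature br v w v = 0}"

locale two_step_nilpotent_algebra =
  fixes br :: "'a::euclidean_space \<Rightarrow> 'a \<Rightarrow> 'a"
  assumes two_step_nilpotent: "two_step_nilpotent br"
begin

lemma bilinear_br: "bilinear br" and br_self [simp]: "br x x = 0"
  and br_br_left [simp]: "br (br x y) z = 0"
  using two_step_nilpotent by (auto simp: two_step_nilpotent_def)

lemmas br_bilinear_simps =
  bilinear_ladd[OF bilinear_br] bilinear_radd[OF bilinear_br]
  bilinear_lmul[OF bilinear_br] bilinear_rmul[OF bilinear_br]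
  bilinear_lneg[OF bilinear_br] bilinear_rneg[OF bilinear_br]
  bilinear_lzero[OF bilinear_br] bilinear_rzero[OF bilinear_br]
  bilinear_lsub[OF bilinear_br] bilinear_rsub[OF bilinear_br]

lemma linear_br: "linear (br x)"
  using bilinear_br by (simp add: bilinear_def)

lemma br_antisym: "br x y = - br y x"
proof -
  have "br (x + y) (x + y) = br x y + br y x"
    unfolding br_bilinear_simps by simp
  then show ?thesis
    by (simp add: eq_neg_iff_add_eq_0)
qed

lemma br_br_right [simp]: "br x (br y z) = 0"
  using br_antisym[of x "br y z"] by simp

lemma inner_adjoint_br: "x \<bullet> adjoint (br a) y = br a x \<bullet> y" "adjoint (br a) y \<bullet> x = br a x \<bullet> y"
  using adjoint_works[OF linear_br] by (auto simp: inner_commute)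

text \<open>\<open>adjoint\<close> is known only through inner products, so additivity and
  homogeneity, also in the slot \<open>a\<close> of \<open>adjoint (br a)\<close>, are checked after
  pairing with basis vectors.\<close>

lemma bilinear_lie_connection: "bilinear (lie_connection br)"
proof -
  have "linear (lie_connection br a)" for a
    by (rule linearI; subst euclidean_eq_iff)
      (simp_all add: lie_connection_def inner_adjoint_br inner_simps br_bilinear_simps algebra_simps)
  moreover have "linear (\<lambda>a. lie_connection br a b)" for b
    by (rule linearI; subst euclidean_eq_iff)
      (simp_all add: lie_connection_def inner_adjoint_br inner_simps br_bilinear_simps algebra_simps)
  ultimately show ?thesis
    by (simp add: bilinear_def)
qed

lemmas lie_connection_simps =
  bilinear_ladd[OF bilinear_lie_connection] bilinear_radd[OF bilinear_lie_connection]
  bilinear_lmul[OF bilinear_lie_connection] bilinear_rmul[OF bilinear_lie_connection]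
  bilinear_lneg[OF bilinear_lie_connection] bilinear_rneg[OF bilinear_lie_connection]
  bilinear_lzero[OF bilinear_lie_connection] bilinear_rzero[OF bilinear_lie_connection]
  bilinear_lsub[OF bilinear_lie_connection] bilinear_rsub[OF bilinear_lie_connection]

text \<open>
  Left translation by \<open>- x\<close> identifies the tangent space at \<open>x\<close> with the Lie algebra;
  \<open>from_algebra x\<close> is the inverse.
\<close>

definition to_algebra :: "'a \<Rightarrow> 'a \<Rightarrow> 'a" where
  "to_algebra x u = u - (1/2) *\<^sub>R br x u"

definition from_algebra :: "'a \<Rightarrow> 'a \<Rightarrow> 'a" where
  "from_algebra x u = u + (1/2) *\<^sub>R br x u"

text \<open>Since \<open>br x (br x u) = 0\<close>, the Neumann series inverting
  \<open>id - (1/2) br x\<close> stops after the linear term.\<close>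

lemma to_from_algebra [simp]: "to_algebra x (from_algebra x u) = u"
  and from_to_algebra [simp]: "from_algebra x (to_algebra x u) = u"
  by (simp_all add: to_algebra_def from_algebra_def br_bilinear_simps)

lemma linear_from_algebra: "linear (from_algebra x)"
  by (rule linearI) (simp_all add: from_algebra_def br_bilinear_simps algebra_simps)

text \<open>The correction term is central, so brackets do not see the translation.\<close>

lemma br_to_algebra [simp]: "br (to_algebra x u) v = br u v" "br u (to_algebra x v) = br u v"
  by (simp_all add: to_algebra_def br_bilinear_simps)

lemma from_algebra_br [simp]: "from_algebra x (br u v) = br u v"
  by (simp add: from_algebra_def)

lemma to_algebra_zero [simp]: "to_algebra 0 v = v" "to_algebra x 0 = 0"
  by (simp_all add: to_algebra_def br_bilinear_simps)

lemma from_algebra_eq_0_iff [simp]: "from_algebra x u = 0 \<longleftrightarrow> u = 0"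
  using to_from_algebra[of x u] by (auto simp: from_algebra_def br_bilinear_simps)

lemma to_algebra_eq_0_iff [simp]: "to_algebra x u = 0 \<longleftrightarrow> u = 0"
  by (metis from_algebra_eq_0_iff from_to_algebra)

section \<open>The Levi-Civita connection in the global chart\<close>

lemma left_invariant_metric_eq:
  "left_invariant_metric br x u v = to_algebra x u \<bullet> to_algebra x v"
  by (simp add: left_invariant_metric_def frechet_derivative_group_mult[OF bilinear_br]
      to_algebra_def br_bilinear_simps)

lemma has_derivative_br:
  "((\<lambda>y. br y v) has_derivative (\<lambda>u. br u v)) F" "(br v has_derivative br v) F"
  using bilinear_br unfolding bilinear_def
  by (auto intro!: bounded_linear_imp_has_derivative simp: linear_conv_bounded_linear)

lemma has_derivative_to_algebra:
  "((\<lambda>y. to_algebra y v) has_derivative (\<lambda>u. - (1/2) *\<^sub>R br u v)) F"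
  unfolding to_algebra_def by (auto intro!: derivative_eq_intros has_derivative_br)

lemma frechet_derivative_metric:
  "frechet_derivative (\<lambda>y. left_invariant_metric br y v w) (at x) u =
     - (1/2) * (br u v \<bullet> to_algebra x w + to_algebra x v \<bullet> br u w)"
proof -
  have "((\<lambda>y. left_invariant_metric br y v w) has_derivative
      (\<lambda>u. to_algebra x v \<bullet> (- (1/2) *\<^sub>R br u w) + (- (1/2) *\<^sub>R br u v) \<bullet> to_algebra x w)) (at x)"
    unfolding left_invariant_metric_eq
    by (rule has_derivative_inner[OF has_derivative_to_algebra has_derivative_to_algebra])
  from frechet_derivative_at[OF this, symmetric] show ?thesis
    by (simp add: algebra_simps)
qed

text \<open>This is the symmetric part of \<open>lie_connection\<close>: constant fields commute,
  and in the Koszul formula the terms containing the bracket of \<open>u\<close> and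
  \<open>v\<close> cancel by antisymmetry.\<close>

lemma christoffel_eq:
  "christoffel (left_invariant_metric br) x u v = from_algebra x (- (1/2) *\<^sub>R
     (adjoint (br (to_algebra x u)) (to_algebra x v) + adjoint (br (to_algebra x v)) (to_algebra x u)))"
    (is "_ = from_algebra x ?z")
proof -
  have rhs: "frechet_derivative (\<lambda>y. left_invariant_metric br y v w) (at x) u
    + frechet_derivative (\<lambda>y. left_invariant_metric br y u w) (at x) v
    - frechet_derivative (\<lambda>y. left_invariant_metric br y u v) (at x) w =
    2 * (?z \<bullet> to_algebra x w)" for w
    using br_antisym[of v u] br_antisym[of w u] br_antisym[of w v]
    by (simp add: frechet_derivative_metric inner_adjoint_br inner_simps algebra_simps inner_commute)
  show ?thesis
    unfolding christoffel_def rhs unfolding left_invariant_metric_eq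
  proof (rule the_equality)
    fix z assume z: "\<forall>w. 2 * (to_algebra x z \<bullet> to_algebra x w) = 2 * (?z \<bullet> to_algebra x w)"
    \<comment> \<open>Every \<open>w\<close> has the form \<open>to_algebra x w'\<close>, so the
      condition determines \<open>to_algebra x z\<close>.\<close>
    have "to_algebra x z \<bullet> w = ?z \<bullet> w" for w
      using z[rule_format, of "from_algebra x w"] by simp
    then have "to_algebra x z = ?z"
      by (metis vector_eq_ldot inner_commute)
    then show "z = from_algebra x ?z"
      by (metis from_to_algebra)
  qed simp
qed

text \<open>Here \<open>f'\<close> differentiates the components of \<open>Y\<close> in the
  left-invariant frame. The frame itself depends on the base point; its derivative supplies the skew
  part \<open>(1/2) br\<close> of \<open>lie_connection\<close>, which the Christoffel symbol
  lacks.\<close>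

lemma levi_civita_eq:
  assumes "((\<lambda>y. to_algebra y (Y y)) has_derivative f') (at x)"
  shows "levi_civita (left_invariant_metric br) X Y x =
    from_algebra x (f' (X x) + lie_connection br (to_algebra x (X x)) (to_algebra x (Y x)))"
proof -
  define f where "f = (\<lambda>y. to_algebra y (Y y))"
  have f: "(f has_derivative f') (at x)"
    using assms by (simp add: f_def)
  have Y: "Y = (\<lambda>y. f y + (1/2) *\<^sub>R br y (f y))"
    using from_to_algebra by (auto simp: f_def from_algebra_def)
  interpret bounded_bilinear br
    using bilinear_br by (simp add: bilinear_conv_bounded_bilinear)
  have "(Y has_derivative (\<lambda>u. f' u + (1/2) *\<^sub>R (br x (f' u) + br u (f x)))) (at x)"
    by (subst Y) (intro has_derivative_add has_derivative_scaleR_right f FDERIV has_derivative_ident)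
  from frechet_derivative_at[OF this, symmetric]
  have "frechet_derivative Y (at x) u = f' u + (1/2) *\<^sub>R (br x (f' u) + br u (f x))" for u
    by simp
  then show ?thesis
    by (simp add: levi_civita_def christoffel_eq lie_connection_def f_def from_algebra_def
        br_bilinear_simps algebra_simps)
qed

text \<open>Constant fields commute, so the bracket term of the curvature vanishes. The term with
  \<open>br a b\<close> in \<open>lie_curvature\<close> arises instead from differentiating the
  frame components \<open>to_algebra y v\<close> of a constant field.\<close>

lemma curvature_eq:
  "curvature (left_invariant_metric br) x u v w =
     from_algebra x (lie_curvature br (to_algebra x u) (to_algebra x v) (to_algebra x w))"
proof -
  let ?g = "left_invariant_metric br" and ?\<sigma> = "lie_connection br"
  interpret bounded_bilinear ?\<sigma>
    using bilinear_lie_connection by (simp add: bilinear_conv_bounded_bilinear)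
  have one: "levi_civita ?g (\<lambda>_. v) (\<lambda>_. w) y =
      from_algebra y (- (1/2) *\<^sub>R br v w + ?\<sigma> (to_algebra y v) (to_algebra y w))" for v w y
    by (rule levi_civita_eq[OF has_derivative_to_algebra])
  have two: "levi_civita ?g (\<lambda>_. u) (levi_civita ?g (\<lambda>_. v) (\<lambda>_. w)) x =
      from_algebra x (?\<sigma> (to_algebra x v) (- (1/2) *\<^sub>R br u w) + ?\<sigma> (- (1/2) *\<^sub>R br u v) (to_algebra x w)
        + ?\<sigma> (to_algebra x u) (- (1/2) *\<^sub>R br v w + ?\<sigma> (to_algebra x v) (to_algebra x w)))" for u v
  proof -
    have "((\<lambda>y. to_algebra y (levi_civita ?g (\<lambda>_. v) (\<lambda>_. w) y)) has_derivative
      (\<lambda>u. ?\<sigma> (to_algebra x v) (- (1/2) *\<^sub>R br u w) + ?\<sigma> (- (1/2) *\<^sub>R br u v) (to_algebra x w))) (at x)"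
      unfolding one to_from_algebra
      by (rule derivative_eq_intros FDERIV has_derivative_to_algebra refl)+ simp
    from levi_civita_eq[OF this, where X = "\<lambda>_. u"] show ?thesis
      by (simp only: one[of v w x] to_from_algebra)
  qed
  have three: "levi_civita ?g (vf_bracket (\<lambda>_. u) (\<lambda>_. v)) (\<lambda>_. w) x = 0"
  proof -
    have "vf_bracket (\<lambda>_. u) (\<lambda>_. v) = (\<lambda>_. 0)"
      by (simp add: vf_bracket_def fun_eq_iff frechet_derivative_const)
    then show ?thesis
      by (simp add: one br_bilinear_simps lie_connection_simps)
  qed
  show ?thesis
    unfolding curvature_def curvature_field_def two three
      linear_diff[OF linear_from_algebra, symmetric] diff_zero
  proof (rule arg_cong[of _ _ "from_algebra x"], subst euclidean_eq_iff, intro ballI)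
    fix b :: 'a
    \<comment> \<open>The two covariant derivatives contribute half of the term with
      \<open>br u v\<close> each; this sign makes the halves add up, while the terms with
      \<open>br u w\<close> and \<open>br v w\<close> cancel.\<close>
    have "?\<sigma> (br v u) c \<bullet> b = - (?\<sigma> (br u v) c \<bullet> b)" for c
      using br_antisym[of v u] by (simp add: lie_connection_simps)
    then show "(?\<sigma> (to_algebra x v) (- (1/2) *\<^sub>R br u w) + ?\<sigma> (- (1/2) *\<^sub>R br u v) (to_algebra x w)
        + ?\<sigma> (to_algebra x u) (- (1/2) *\<^sub>R br v w + ?\<sigma> (to_algebra x v) (to_algebra x w))
        - (?\<sigma> (to_algebra x u) (- (1/2) *\<^sub>R br v w) + ?\<sigma> (- (1/2) *\<^sub>R br v u) (to_algebra x w)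
        + ?\<sigma> (to_algebra x v) (- (1/2) *\<^sub>R br u w + ?\<sigma> (to_algebra x u) (to_algebra x w)))) \<bullet> b =
        lie_curvature br (to_algebra x u) (to_algebra x v) (to_algebra x w) \<bullet> b"
      by (simp add: lie_curvature_def lie_connection_simps inner_diff_left inner_add_left)
  qed
qed

section \<open>The infinitesimal rank from Jacobi operators at the identity\<close>

lemma infinitesimal_rank_eq:
  "infinitesimal_rank br = Inf {dim (lie_jacobi_kernel br v) | v. v \<noteq> 0}"
proof -
  have "dim {w. jacobi_operator (left_invariant_metric br) x v w = 0} =
      dim (lie_jacobi_kernel br (to_algebra x v))" for x v
  proof -
    have "{w. jacobi_operator (left_invariant_metric br) x v w = 0} =
        from_algebra x ` lie_jacobi_kernel br (to_algebra x v)"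
      by (auto simp: jacobi_operator_def curvature_eq lie_jacobi_kernel_def image_iff)
        (metis from_to_algebra)
    moreover have "inj (from_algebra x)"
      by (metis injI to_from_algebra)
    ultimately show ?thesis
      by (simp add: dim_image_eq[OF linear_from_algebra] inj_on_subset)
  qed
  then have "{dim {w. jacobi_operator (left_invariant_metric br) x v w = 0} | x v. v \<noteq> 0} =
      {dim (lie_jacobi_kernel br v) | v. v \<noteq> 0}"
    \<comment> \<open>Base point \<open>0\<close>, where \<open>to_algebra\<close> is the identity,
      realises every algebraic kernel.\<close>
    by auto (metis to_algebra_eq_0_iff to_algebra_zero(1))+
  then show ?thesis
    by (simp add: infinitesimal_rank_def riemannian_infinitesimal_rank_def)
qed

lemma self_in_lie_jacobi_kernel: "v \<in> lie_jacobi_kernel br v"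
  by (simp add: lie_jacobi_kernel_def lie_curvature_def lie_connection_simps)

text \<open>The rank is a minimum: a lower bound is needed for all vectors, but an upper bound only
  for one well-chosen \<open>v\<close>, where a spanning set of its kernel suffices.\<close>

lemma infinitesimal_rank_eqI:
  assumes "\<And>v. v \<noteq> 0 \<Longrightarrow> n \<le> dim (lie_jacobi_kernel br v)"
    and "v \<noteq> 0" "lie_jacobi_kernel br v \<subseteq> span B" "finite B" "card B \<le> n"
  shows "infinitesimal_rank br = n"
proof -
  have "dim (lie_jacobi_kernel br v) \<le> n"
    using dim_le_card[OF assms(3,4)] assms(5) by linarith
  then have "n \<in> {dim (lie_jacobi_kernel br v) | v. v \<noteq> 0}"
    using assms(1,2) by (auto intro!: exI[of _ v] le_antisym)
  then show ?thesis
    unfolding infinitesimal_rank_eq using assms(1) by (auto intro!: cInf_eq_minimum)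
qed

text \<open>As \<open>v\<close> lies in its own kernel, one further independent vector is
  enough.\<close>

lemma two_le_dim_lie_jacobi_kernel:
  assumes "v \<noteq> 0" "w \<in> lie_jacobi_kernel br v" "w \<notin> span {v}"
  shows "2 \<le> dim (lie_jacobi_kernel br v)"
proof -
  have "independent {w, v}"
    using assms by (simp add: independent_insert)
  moreover have "w \<noteq> v"
    using assms(3) by (auto simp: span_base)
  ultimately show ?thesis
    using independent_card_le_dim[of "{w, v}" "lie_jacobi_kernel br v"]
      assms(2) self_in_lie_jacobi_kernel by simp
qed

lemma one_le_dim_lie_jacobi_kernel: "v \<noteq> 0 \<Longrightarrow> 1 \<le> dim (lie_jacobi_kernel br v)"
  using independent_card_le_dim[of "{v}" "lie_jacobi_kernel br v"] self_in_lie_jacobi_kernel by simp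

end

section \<open>The family of metric Lie algebras\<close>

lemma exhaust_6: "x = 1 \<or> x = 2 \<or> x = 3 \<or> x = 4 \<or> x = 5 \<or> x = 6" for x :: 6
proof (induct x)
  case (of_int z)
  then have "z = 0 \<or> z = 1 \<or> z = 2 \<or> z = 3 \<or> z = 4 \<or> z = 5"
    by auto
  then show ?case
    by auto
qed

lemma forall_6: "(\<forall>i::6. P i) \<longleftrightarrow> P 1 \<and> P 2 \<and> P 3 \<and> P 4 \<and> P 5 \<and> P 6"
  by (metis exhaust_6)

lemma UNIV_6: "(UNIV :: 6 set) = {1, 2, 3, 4, 5, 6}"
  using exhaust_6 by auto

lemma sum_6: "sum f (UNIV :: 6 set) = f 1 + f 2 + f 3 + f 4 + f 5 + f 6"
  unfolding UNIV_6 by (simp add: ac_simps)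

lemma exhaust_5: "x = 1 \<or> x = 2 \<or> x = 3 \<or> x = 4 \<or> x = 5" for x :: 5
proof (induct x)
  case (of_int z)
  then have "z = 0 \<or> z = 1 \<or> z = 2 \<or> z = 3 \<or> z = 4"
    by auto
  then show ?case
    by auto
qed

lemma forall_5: "(\<forall>i::5. P i) \<longleftrightarrow> P 1 \<and> P 2 \<and> P 3 \<and> P 4 \<and> P 5"
  by (metis exhaust_5)

definition vec6 :: "real \<Rightarrow> real \<Rightarrow> real \<Rightarrow> real \<Rightarrow> real \<Rightarrow> real \<Rightarrow> real^6" where
  "vec6 x1 x2 x3 x4 x5 x6 = (\<chi> i. if i = 1 then x1 else if i = 2 then x2 else if i = 3 then x3
     else if i = 4 then x4 else if i = 5 then x5 else x6)"

lemma vec6_nth [simp]: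
  "vec6 x1 x2 x3 x4 x5 x6 $ 1 = x1" "vec6 x1 x2 x3 x4 x5 x6 $ 2 = x2"
  "vec6 x1 x2 x3 x4 x5 x6 $ 3 = x3" "vec6 x1 x2 x3 x4 x5 x6 $ 4 = x4"
  "vec6 x1 x2 x3 x4 x5 x6 $ 5 = x5" "vec6 x1 x2 x3 x4 x5 x6 $ 6 = x6"
  by (simp_all add: vec6_def)

lemma vec6_eq_iff: "x = y \<longleftrightarrow> x $ 1 = y $ 1 \<and> x $ 2 = y $ 2 \<and> x $ 3 = y $ 3 \<and>
    x $ 4 = y $ 4 \<and> x $ 5 = y $ 5 \<and> x $ 6 = y $ 6" for x y :: "real^6"
  by (simp only: vec_eq_iff forall_6)

lemma inner_vec6: "x \<bullet> y = x $ 1 * y $ 1 + x $ 2 * y $ 2 + x $ 3 * y $ 3 +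
    x $ 4 * y $ 4 + x $ 5 * y $ 5 + x $ 6 * y $ 6" for x y :: "real^6"
  by (simp only: inner_vec_def sum_6 inner_real_def)

text \<open>The coefficients of the structure equations; \<open>m2\<close> enters \<open>de\<close>
  at index 6 with a minus sign. They are parameters, so that the exceptional points can be
  interpreted with simplified values instead of the square roots.\<close>

locale n_algebra =
  fixes \<alpha>p \<alpha>m l1 l2 m1 m2 :: real
  assumes l1: "l1 = sqrt \<alpha>m + sqrt (1 - \<alpha>m)" and l2: "l2 = sqrt \<alpha>m - sqrt (1 - \<alpha>m)"
    and m1: "m1 = sqrt (1 - \<alpha>p) + sqrt \<alpha>p" and m2: "m2 = sqrt (1 - \<alpha>p) - sqrt \<alpha>p"
begin

sublocale two_step_nilpotent_algebra "n_bracket \<alpha>p \<alpha>m"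
  by unfold_locales (rule two_step_nilpotent_n_bracket)

lemma n_bracket_eq: "n_bracket \<alpha>p \<alpha>m x y = vec6 0 0 0 0
    (- (l1 * (x $ 1 * y $ 2 - x $ 2 * y $ 1) + l2 * (x $ 3 * y $ 4 - x $ 4 * y $ 3)))
    (- (m1 * (x $ 1 * y $ 3 - x $ 3 * y $ 1) - m2 * (x $ 2 * y $ 4 - x $ 4 * y $ 2)))"
  by (simp add: vec6_eq_iff n_bracket_def structure_bracket_def wedge_def Let_def l1 l2 m1 m2)

lemma adjoint_n_bracket_eq: "adjoint (n_bracket \<alpha>p \<alpha>m x) z = vec6
    (l1 * z $ 5 * x $ 2 + m1 * z $ 6 * x $ 3) (- l1 * z $ 5 * x $ 1 - m2 * z $ 6 * x $ 4)
    (l2 * z $ 5 * x $ 4 - m1 * z $ 6 * x $ 1) (- l2 * z $ 5 * x $ 3 + m2 * z $ 6 * x $ 2) 0 0"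
  by (rule fun_cong[of _ _ z], rule adjoint_unique) (simp add: inner_vec6 n_bracket_eq algebra_simps)

lemma lie_connection_eq: "lie_connection (n_bracket \<alpha>p \<alpha>m) x y = (1/2) *\<^sub>R vec6
    (- (l1 * y $ 5 * x $ 2 + m1 * y $ 6 * x $ 3) - (l1 * x $ 5 * y $ 2 + m1 * x $ 6 * y $ 3))
    ((l1 * y $ 5 * x $ 1 + m2 * y $ 6 * x $ 4) + (l1 * x $ 5 * y $ 1 + m2 * x $ 6 * y $ 4))
    (- (l2 * y $ 5 * x $ 4 - m1 * y $ 6 * x $ 1) - (l2 * x $ 5 * y $ 4 - m1 * x $ 6 * y $ 1))
    ((l2 * y $ 5 * x $ 3 - m2 * y $ 6 * x $ 2) + (l2 * x $ 5 * y $ 3 - m2 * x $ 6 * y $ 2))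
    (- (l1 * (x $ 1 * y $ 2 - x $ 2 * y $ 1) + l2 * (x $ 3 * y $ 4 - x $ 4 * y $ 3)))
    (- (m1 * (x $ 1 * y $ 3 - x $ 3 * y $ 1) - m2 * (x $ 2 * y $ 4 - x $ 4 * y $ 2)))"
  by (simp add: lie_connection_def n_bracket_eq adjoint_n_bracket_eq vec6_eq_iff)

lemmas jacobi_simps = lie_jacobi_kernel_def lie_curvature_def lie_connection_eq n_bracket_eq vec6_eq_iff

text \<open>For this vector the Jacobi operator splits into blocks: coordinates 1 and 4 stand alone,
  2 is coupled with 5 (where the vector itself is the expected solution) and 3 with 6.\<close>

lemma lie_jacobi_kernel_e2_e5:
  assumes "w \<in> lie_jacobi_kernel (n_bracket \<alpha>p \<alpha>m) (vec6 0 1 0 0 s 0)"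
  shows "l1\<^sup>2 * (3 - s\<^sup>2) * w $ 1 = 0" "l1\<^sup>2 * (w $ 5 - s * w $ 2) = 0"
    "(2 * l1 * m1 + l2 * m2) * s * w $ 6 = l2\<^sup>2 * s\<^sup>2 * w $ 3"
    "(3 * m2\<^sup>2 - l2\<^sup>2 * s\<^sup>2) * w $ 4 = 0"
    "(2 * l1 * m1 + l2 * m2) * s * w $ 3 = m2\<^sup>2 * w $ 6"
  using assms by (simp_all add: jacobi_simps power2_eq_square field_simps) auto

lemma in_span_vec6: "w $ 1 = 0 \<Longrightarrow> w $ 5 = s * w $ 2 \<Longrightarrow> w $ 3 = 0 \<Longrightarrow> w $ 4 = 0 \<Longrightarrow> w $ 6 = 0 \<Longrightarrow>
    w \<in> span {vec6 0 1 0 0 s 0}"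
  by (auto simp: span_singleton vec6_eq_iff intro!: exI[of _ "w $ 2"])

lemma infinitesimal_rank_eq_1:
  assumes "0 \<le> \<alpha>p" "\<alpha>p \<le> \<alpha>m" "\<alpha>p + \<alpha>m \<le> 1" "(\<alpha>p, \<alpha>m) \<noteq> (0, 0)" "(\<alpha>p, \<alpha>m) \<noteq> (1/2, 1/2)"
  shows "infinitesimal_rank (n_bracket \<alpha>p \<alpha>m) = 1"
proof (rule infinitesimal_rank_eqI[OF one_le_dim_lie_jacobi_kernel])
  define a b p q where abpq: "a = sqrt \<alpha>m" "b = sqrt (1 - \<alpha>p)" "p = sqrt (1 - \<alpha>m)" "q = sqrt \<alpha>p"
  \<comment> \<open>The excluded points enter here: \<open>\<alpha>m = 0\<close> would force
    \<open>(0, 0)\<close>, and \<open>\<alpha>p = 1/2\<close> would force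
    \<open>(1/2, 1/2)\<close>.\<close>
  have ranges: "0 < \<alpha>m" "\<alpha>m \<le> 1" "\<alpha>p < 1/2"
    using assms by auto
  have nonneg: "0 < a" "0 < b" "0 \<le> p" "0 \<le> q" "q < b"
    using ranges assms by (auto simp: abpq)
  have sq: "a\<^sup>2 = \<alpha>m" "b\<^sup>2 = 1 - \<alpha>p" "p\<^sup>2 = 1 - \<alpha>m" "q\<^sup>2 = \<alpha>p"
    using ranges assms by (auto simp: abpq)
  have lm: "l1 = a + p" "l2 = a - p" "m1 = b + q" "m2 = b - q"
    by (simp_all add: l1 l2 m1 m2 abpq)
  have pos: "l1 > 0" "m1 > 0" "m2 > 0"
    using nonneg by (simp_all add: lm)
  have "m2\<^sup>2 = 1 - 2 * (b * q)" "l2\<^sup>2 = 1 - 2 * (a * p)"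
    using sq by (simp_all add: lm power2_diff)
  moreover have "0 \<le> b * q" "0 \<le> a * p"
    using nonneg by simp_all
  \<comment> \<open>These bounds keep the factors \<open>3 - m2\<^sup>2\<close> and
    \<open>3 - l2\<^sup>2\<close> positive.\<close>
  ultimately have le: "m2\<^sup>2 \<le> 1" "l2\<^sup>2 \<le> 1"
    by linarith+
  \<comment> \<open>With \<open>s = m2\<close> a power of \<open>m2\<close> can be cancelled from
    the equations for coordinates 3, 4 and 6, which leaves \<open>3 - l2\<^sup>2\<close> as the
    coefficient of \<open>w $ 4\<close>.\<close>
  show "vec6 0 1 0 0 m2 0 \<noteq> 0"
    by (simp add: vec6_eq_iff)
  show "lie_jacobi_kernel (n_bracket \<alpha>p \<alpha>m) (vec6 0 1 0 0 m2 0) \<subseteq> span {vec6 0 1 0 0 m2 0}"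
  proof
    fix w assume "w \<in> lie_jacobi_kernel (n_bracket \<alpha>p \<alpha>m) (vec6 0 1 0 0 m2 0)"
    note eqs = lie_jacobi_kernel_e2_e5[OF this]
    \<comment> \<open>The equations for \<open>w $ 3\<close> and \<open>w $ 6\<close> decouple from the others; the determinant of this
      system is, up to a nonzero factor, \<open>k\<^sup>2 - (l2 * m2)\<^sup>2\<close>.\<close>
    define k where "k = 2 * l1 * m1 + l2 * m2"
    have "3 * m2\<^sup>2 - l2\<^sup>2 * m2\<^sup>2 = (3 - l2\<^sup>2) * m2\<^sup>2"
      by (simp add: algebra_simps)
    then have w145: "w $ 1 = 0" "w $ 4 = 0" "w $ 5 = m2 * w $ 2"
      using eqs(1,2,4) pos le by auto
    have k6: "k * w $ 6 = l2\<^sup>2 * m2 * w $ 3" and k3: "k * w $ 3 = m2 * w $ 6"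
      using eqs(3,5) pos by (auto simp: k_def power2_eq_square)
    have "k * (k * w $ 3) = m2 * (k * w $ 6)"
      by (simp add: k3)
    then have "(k - l2 * m2) * (k + l2 * m2) * w $ 3 = 0"
      by (simp add: k6 power2_eq_square algebra_simps)
    moreover have "k - l2 * m2 > 0"
      using pos by (simp add: k_def)
    moreover have "k + l2 * m2 = 4 * (a * b + p * q)"
      by (simp add: k_def lm algebra_simps)
    \<comment> \<open>This sum vanishes at \<open>(0, 0)\<close>, where \<open>a = q = 0\<close>;
      otherwise \<open>a * b\<close> is positive.\<close>
    moreover have "a * b + p * q > 0"
      using nonneg by (simp add: add_pos_nonneg)
    ultimately have "w $ 3 = 0"
      by auto
    then show "w \<in> span {vec6 0 1 0 0 m2 0}"
      using k3 pos w145 by (intro in_span_vec6) auto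
  qed
qed simp_all

end

subsection \<open>The two exceptional points\<close>

interpretation n00: n_algebra 0 0 1 "- 1" 1 1
  by unfold_locales simp_all

interpretation n55: n_algebra "1/2" "1/2" "sqrt 2" 0 "sqrt 2" 0
proof -
  have "sqrt (1/2) + sqrt (1/2) = sqrt 2"
    by (simp add: real_sqrt_divide field_simps)
  then show "n_algebra (1/2) (1/2) (sqrt 2) 0 (sqrt 2) 0"
    by unfold_locales simp_all
qed

lemma infinitesimal_rank_n00: "infinitesimal_rank (n_bracket 0 0) = 2"
proof (rule n00.infinitesimal_rank_eqI)
  fix v :: "real^6" assume "v \<noteq> 0"
  \<comment> \<open>The two Heisenberg factors are the eigenspaces of \<open>T\<close> for 1 and -1,
    spanned by e1 + e4, e2 + e3, e5 + e6 and by e1 - e4, e2 - e3, e5 - e6.\<close>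
  define T :: "real^6 \<Rightarrow> real^6"
    where "T u = vec6 (u $ 4) (u $ 3) (u $ 2) (u $ 1) (u $ 6) (u $ 5)" for u
  have T: "T (T u) = u" "T (c *\<^sub>R u) = c *\<^sub>R T u" for u c
    by (simp_all add: T_def vec6_eq_iff)
  define t where "t = T v"
  \<comment> \<open>In each factor the component of \<open>t\<close> is plus or minus that of
    \<open>v\<close>, so the curvature of the product vanishes on the pair.\<close>
  have t: "t \<in> lie_jacobi_kernel (n_bracket 0 0) v"
    by (simp add: n00.jacobi_simps t_def T_def algebra_simps)
  consider "t = v" | "t = - v" | "t \<noteq> v" "t \<noteq> - v"
    by blast
  then have "\<exists>w \<in> lie_jacobi_kernel (n_bracket 0 0) v. w \<notin> span {v}"
  proof cases
    case 1
    have "v $ 4 = v $ 1" "v $ 3 = v $ 2" "v $ 6 = v $ 5"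
      using arg_cong[OF 1, of "\<lambda>u. u $ 1"] arg_cong[OF 1, of "\<lambda>u. u $ 2"] arg_cong[OF 1, of "\<lambda>u. u $ 5"]
      by (simp_all add: t_def T_def)
    then have v: "v = vec6 (v $ 1) (v $ 2) (v $ 2) (v $ 1) (v $ 5) (v $ 5)"
      by (simp add: vec6_eq_iff)
    \<comment> \<open>Now \<open>v\<close> lies in the first factor; the witness is taken from the
      second one.\<close>
    have "vec6 1 0 0 (- 1) 0 0 \<in> lie_jacobi_kernel (n_bracket 0 0) v"
      by (subst v) (simp add: n00.jacobi_simps algebra_simps)
    moreover have "vec6 1 0 0 (- 1) 0 0 \<notin> span {v}"
      by (subst v) (auto simp: span_singleton vec6_eq_iff)
    ultimately show ?thesis by blast
  next
    case 2
    have "v $ 4 = - v $ 1" "v $ 3 = - v $ 2" "v $ 6 = - v $ 5"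
      using arg_cong[OF 2, of "\<lambda>u. u $ 1"] arg_cong[OF 2, of "\<lambda>u. u $ 2"] arg_cong[OF 2, of "\<lambda>u. u $ 5"]
      by (simp_all add: t_def T_def)
    then have v: "v = vec6 (v $ 1) (v $ 2) (- v $ 2) (- v $ 1) (v $ 5) (- v $ 5)"
      by (simp add: vec6_eq_iff)
    have "vec6 1 0 0 1 0 0 \<in> lie_jacobi_kernel (n_bracket 0 0) v"
      by (subst v) (simp add: n00.jacobi_simps algebra_simps)
    moreover have "vec6 1 0 0 1 0 0 \<notin> span {v}"
      by (subst v) (auto simp: span_singleton vec6_eq_iff)
    ultimately show ?thesis by blast
  next
    case 3
    \<comment> \<open>\<open>T\<close> is an involution, so its only possible eigenvalues are 1 and
      -1, both excluded in this case.\<close>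
    have "t \<notin> span {v}"
    proof
      assume "t \<in> span {v}"
      then obtain c where c: "t = c *\<^sub>R v"
        by (auto simp: span_singleton)
      have "c *\<^sub>R c *\<^sub>R v = c *\<^sub>R T v"
        using c by (simp add: t_def)
      also have "\<dots> = T (T v)"
        using T(2)[of c v] c by (simp add: t_def)
      finally have "c *\<^sub>R c *\<^sub>R v = v"
        by (simp only: T(1))
      then have "c\<^sup>2 = 1"
        using \<open>v \<noteq> 0\<close> by (metis scaleR_cancel_right scaleR_one scaleR_scaleR power2_eq_square)
      then show False
        using c 3 by (auto simp: power2_eq_1_iff)
    qed
    then show ?thesis
      using t by blast
  qed
  then show "2 \<le> dim (lie_jacobi_kernel (n_bracket 0 0) v)"
    using n00.two_le_dim_lie_jacobi_kernel[OF \<open>v \<noteq> 0\<close>] by blast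
next
  \<comment> \<open>For the central vector e5 the Jacobi operator is nondegenerate on e1, ..., e4,
    because \<open>l1\<close> and \<open>l2\<close> are nonzero; only the centre remains.\<close>
  show "vec6 0 0 0 0 1 0 \<noteq> 0"
    by (simp add: vec6_eq_iff)
  show "lie_jacobi_kernel (n_bracket 0 0) (vec6 0 0 0 0 1 0) \<subseteq>
      span {vec6 0 0 0 0 1 0, vec6 0 0 0 0 0 1}"
  proof
    fix w assume "w \<in> lie_jacobi_kernel (n_bracket 0 0) (vec6 0 0 0 0 1 0)"
    then have "w = w $ 5 *\<^sub>R vec6 0 0 0 0 1 0 + w $ 6 *\<^sub>R vec6 0 0 0 0 0 1"
      by (simp add: n00.jacobi_simps)
    then show "w \<in> span {vec6 0 0 0 0 1 0, vec6 0 0 0 0 0 1}"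
      by (metis span_add span_scale span_base insertCI)
  qed
qed (simp_all add: card_insert_if)

lemma infinitesimal_rank_n55: "infinitesimal_rank (n_bracket (1/2) (1/2)) = 2"
proof (rule n55.infinitesimal_rank_eqI)
  fix v :: "real^6" assume "v \<noteq> 0"
  have "\<exists>w \<in> lie_jacobi_kernel (n_bracket (1/2) (1/2)) v. w \<notin> span {v}"
  proof (cases "vec6 0 0 0 1 0 0 \<in> span {v}")
    case True
    then obtain c where c: "vec6 0 0 0 1 0 0 = c *\<^sub>R v"
      by (auto simp: span_singleton)
    then have v: "v = vec6 0 0 0 (v $ 4) 0 0"
      by (auto simp: vec6_eq_iff)
    \<comment> \<open>A vector of the flat factor has zero Jacobi operator, so any vector off its
      line would serve.\<close>
    have "vec6 1 0 0 0 0 0 \<in> lie_jacobi_kernel (n_bracket (1/2) (1/2)) v"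
      by (subst v) (simp add: n55.jacobi_simps)
    moreover have "vec6 1 0 0 0 0 0 \<notin> span {v}"
      by (subst v) (auto simp: span_singleton vec6_eq_iff)
    ultimately show ?thesis by blast
  next
    case False
    moreover have "vec6 0 0 0 1 0 0 \<in> lie_jacobi_kernel (n_bracket (1/2) (1/2)) v"
      by (simp add: n55.jacobi_simps)
    ultimately show ?thesis by blast
  qed
  then show "2 \<le> dim (lie_jacobi_kernel (n_bracket (1/2) (1/2)) v)"
    using n55.two_le_dim_lie_jacobi_kernel[OF \<open>v \<noteq> 0\<close>] by blast
next
  \<comment> \<open>Since \<open>l2 = 0\<close>, the vector e5 would leave a larger kernel; for e1
    only e1 and the flat direction e4 remain.\<close>
  show "vec6 1 0 0 0 0 0 \<noteq> 0"
    by (simp add: vec6_eq_iff)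
  show "lie_jacobi_kernel (n_bracket (1/2) (1/2)) (vec6 1 0 0 0 0 0) \<subseteq>
      span {vec6 1 0 0 0 0 0, vec6 0 0 0 1 0 0}"
  proof
    fix w assume "w \<in> lie_jacobi_kernel (n_bracket (1/2) (1/2)) (vec6 1 0 0 0 0 0)"
    then have "w = w $ 1 *\<^sub>R vec6 1 0 0 0 0 0 + w $ 4 *\<^sub>R vec6 0 0 0 1 0 0"
      by (simp add: n55.jacobi_simps)
    then show "w \<in> span {vec6 1 0 0 0 0 0, vec6 0 0 0 1 0 0}"
      by (metis span_add span_scale span_base insertCI)
  qed
qed (simp_all add: card_insert_if)

section \<open>Product decompositions at the exceptional points\<close>

lemma isometric_to_product_n00: "isometric_to_product (n_bracket 0 0) h3_bracket h3_bracket"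
proof -
  \<comment> \<open>In the bases e1 + e4, e2 + e3 and e1 - e4, e2 - e3 the mixed brackets cancel and
    the others double, whence the factor 2 on the centre. \<open>s\<close> is the scalar product
    pulled back to either factor, and \<open>\<psi>\<close> is the inverse.\<close>
  define \<phi> :: "(real^3) \<times> (real^3) \<Rightarrow> real^6" where
    "\<phi> = (\<lambda>(x, y). vec6 (x $ 1 + y $ 1) (x $ 2 + y $ 2) (x $ 2 - y $ 2) (x $ 1 - y $ 1)
       (2 * (x $ 3 + y $ 3)) (2 * (x $ 3 - y $ 3)))"
  define s :: "real^3 \<Rightarrow> real^3 \<Rightarrow> real" where
    "s x y = 2 * x $ 1 * y $ 1 + 2 * x $ 2 * y $ 2 + 8 * x $ 3 * y $ 3" for x y
  define \<psi> :: "real^6 \<Rightarrow> (real^3) \<times> (real^3)" where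
    "\<psi> z = (vector [(z $ 1 + z $ 4) / 2, (z $ 2 + z $ 3) / 2, (z $ 5 + z $ 6) / 4],
            vector [(z $ 1 - z $ 4) / 2, (z $ 2 - z $ 3) / 2, (z $ 5 - z $ 6) / 4])" for z
  have "s x x > 0" if "x \<noteq> 0" for x
  proof -
    have "x $ 1 \<noteq> 0 \<or> x $ 2 \<noteq> 0 \<or> x $ 3 \<noteq> 0"
      using that by (auto simp: vec_eq_iff forall_3)
    moreover have "s x x = 2 * (x $ 1)\<^sup>2 + 2 * (x $ 2)\<^sup>2 + 8 * (x $ 3)\<^sup>2"
      by (simp add: s_def power2_eq_square)
    ultimately show ?thesis
      by (auto simp: add_pos_nonneg add_nonneg_pos)
  qed
  moreover have "bilinear s"
    unfolding bilinear_def by (auto intro!: linearI simp: s_def algebra_simps)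
  ultimately have "scalar_product s"
    by (simp add: scalar_product_def) (simp add: s_def algebra_simps)
  moreover have "linear \<phi>"
    by (rule linearI) (auto simp: \<phi>_def vec6_eq_iff algebra_simps)
  moreover have "bij \<phi>"
  proof (rule o_bij)
    show "\<psi> \<circ> \<phi> = id"
      by (auto simp: fun_eq_iff \<psi>_def \<phi>_def vec_eq_iff forall_3 vector_3)
    show "\<phi> \<circ> \<psi> = id"
      by (auto simp: fun_eq_iff \<psi>_def \<phi>_def vec6_eq_iff vector_3 field_simps)
  qed
  moreover have "\<phi> (direct_sum_bracket h3_bracket h3_bracket x y) = n_bracket 0 0 (\<phi> x) (\<phi> y)" for x y
    by (simp add: direct_sum_bracket_def h3_bracket_def structure_bracket_def wedge_def
        n00.n_bracket_eq \<phi>_def vec6_eq_iff split_beta algebra_simps)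
  moreover have "\<phi> x \<bullet> \<phi> y = s (fst x) (fst y) + s (snd x) (snd y)" for x y
    by (simp add: \<phi>_def s_def inner_vec6 split_beta algebra_simps)
  ultimately show ?thesis
    unfolding isometric_to_product_def by blast
qed

lemma isometric_to_product_n55:
  "isometric_to_product (n_bracket (1/2) (1/2)) n5_bracket (abelian_bracket :: real \<Rightarrow> real \<Rightarrow> real)"
proof -
  \<comment> \<open>With \<open>l2 = m2 = 0\<close> the vector e4 is central and splits off; the
    factor \<open>sqrt 2\<close> absorbs \<open>l1 = m1 = sqrt 2\<close>.\<close>
  define \<phi> :: "(real^5) \<times> real \<Rightarrow> real^6" where
    "\<phi> = (\<lambda>(x, y). vec6 (x $ 1) (x $ 2) (x $ 3) y (sqrt 2 * x $ 4) (sqrt 2 * x $ 5))"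
  define s :: "real^5 \<Rightarrow> real^5 \<Rightarrow> real" where
    "s x y = x $ 1 * y $ 1 + x $ 2 * y $ 2 + x $ 3 * y $ 3 + 2 * x $ 4 * y $ 4 + 2 * x $ 5 * y $ 5" for x y
  define \<psi> :: "real^6 \<Rightarrow> (real^5) \<times> real" where
    "\<psi> z = ((\<chi> i. if i = 4 then z $ 5 / sqrt 2 else if i = 5 then z $ 6 / sqrt 2
       else if i = 1 then z $ 1 else if i = 2 then z $ 2 else z $ 3), z $ 4)" for z
  have "s x x > 0" if "x \<noteq> 0" for x
  proof -
    have "x $ 1 \<noteq> 0 \<or> x $ 2 \<noteq> 0 \<or> x $ 3 \<noteq> 0 \<or> x $ 4 \<noteq> 0 \<or> x $ 5 \<noteq> 0"
      using that by (auto simp: vec_eq_iff forall_5)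
    moreover have "s x x = (x $ 1)\<^sup>2 + (x $ 2)\<^sup>2 + (x $ 3)\<^sup>2 + 2 * (x $ 4)\<^sup>2 + 2 * (x $ 5)\<^sup>2"
      by (simp add: s_def power2_eq_square)
    ultimately show ?thesis
      by (auto simp: add_pos_nonneg add_nonneg_pos)
  qed
  moreover have "bilinear s"
    unfolding bilinear_def by (auto intro!: linearI simp: s_def algebra_simps)
  ultimately have "scalar_product s"
    by (simp add: scalar_product_def) (simp add: s_def algebra_simps)
  moreover have "scalar_product ((*) :: real \<Rightarrow> real \<Rightarrow> real)"
    by (auto simp: scalar_product_def bilinear_def zero_less_mult_iff intro!: linearI algebra_simps)
  moreover have "linear \<phi>"
    by (rule linearI) (auto simp: \<phi>_def vec6_eq_iff algebra_simps)
  moreover have "bij \<phi>"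
  proof (rule o_bij)
    show "\<psi> \<circ> \<phi> = id"
      by (auto simp: fun_eq_iff \<psi>_def \<phi>_def vec_eq_iff forall_5)
    show "\<phi> \<circ> \<psi> = id"
      by (auto simp: fun_eq_iff \<psi>_def \<phi>_def vec6_eq_iff)
  qed
  moreover have "\<phi> (direct_sum_bracket n5_bracket abelian_bracket x y) =
      n_bracket (1/2) (1/2) (\<phi> x) (\<phi> y)" for x y
    unfolding n55.n_bracket_eq
    by (simp add: direct_sum_bracket_def n5_bracket_def structure_bracket_def wedge_def
        abelian_bracket_def \<phi>_def vec6_eq_iff split_beta algebra_simps)
  moreover have sqrt2: "sqrt 2 * (sqrt 2 * z) = 2 * z" for z
    by (simp flip: mult.assoc)
  have "\<phi> x \<bullet> \<phi> y = s (fst x) (fst y) + snd x * snd y" for x y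
    by (simp add: sqrt2 \<phi>_def s_def inner_vec6 split_beta algebra_simps)
  ultimately show ?thesis
    unfolding isometric_to_product_def by blast
qed

theorem mainTheorem5:
  fixes \<alpha>p \<alpha>m :: real
  assumes "0 \<le> \<alpha>p" and "\<alpha>p \<le> \<alpha>m" and "\<alpha>p + \<alpha>m \<le> 1"
  shows "((\<alpha>p, \<alpha>m) \<noteq> (0, 0) \<and> (\<alpha>p, \<alpha>m) \<noteq> (1/2, 1/2) \<longrightarrow>
            infinitesimal_rank (n_bracket \<alpha>p \<alpha>m) = 1)
       \<and> isometric_to_product (n_bracket 0 0) h3_bracket h3_bracket
       \<and> infinitesimal_rank (n_bracket 0 0) = 2
       \<and> isometric_to_product (n_bracket (1/2) (1/2))
            n5_bracket (abelian_bracket :: real \<Rightarrow> real \<Rightarrow> real)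
       \<and> infinitesimal_rank (n_bracket (1/2) (1/2)) = 2"
  using n_algebra.infinitesimal_rank_eq_1[OF n_algebra.intro[OF refl refl refl refl] assms]
    isometric_to_product_n00 infinitesimal_rank_n00 isometric_to_product_n55 infinitesimal_rank_n55
  by blast

end
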